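(* Let $(a_n)_{n=1}^\infty$ be a Roth–Szekeres sequence, and let $s=\lim_{n\to\infty}\frac{\log a_n}{\log n}$. Then for every $\epsilon>0$, \[ \int_0^{\pi/2} \prod_{i=1}^n \cos(a_i t)\, dt = \frac{1}{2}\sqrt{\frac{2\pi}{\sum_{i=1}^n a_i^2}} - \frac{\sqrt{2\pi}\,\sum_{i=1}^n a_i^4}{8\left(\sum_{i=1}^n a_i^2\right)^{5/2}} + O\!\left(n^{-s-5/2+\epsilon}\right) \quad (n\to\infty). \]
   Context: For real $x$, $\|x\|$ denotes the distance from $x$ to the nearest integer. A sequence of positive integers $(a_n)_{n=1}^\infty$ is called a Roth–Szekeres sequence if it satisfies: (C1) $a_{n+1}\ge a_n$ for all sufficiently large $n$; (C2) the limit $s=\lim_{n\to\infty}\frac{\log a_n}{\log n}$ exists and is positive; (C3) $J_n:=\inf_{(2a_n)^{-1}<t\le 1/2} \frac{\sum_{i=1}^n \|a_i t\|^2}{\log n}\to\infty$ as $n\to\infty$. *)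

theory Defs
  imports "HOL-Analysis.Analysis" "HOL-Library.Landau_Symbols"
begin

definition dist_int :: "real \<Rightarrow> real" where
  "dist_int x = \<bar>x - of_int (round x)\<bar>"

(* The index range of the infimum is empty when a n = 1, and the value is then unspecified.
   For a sequence satisfying (C2) this happens for finitely many n only, so (C3) is unaffected. *)
definition rs_J :: "(nat \<Rightarrow> nat) \<Rightarrow> nat \<Rightarrow> real" where
  "rs_J a n = (INF t\<in>{1 / (2 * real (a n)) <.. 1/2}.
                 (\<Sum>i=1..n. (dist_int (real (a i) * t))\<^sup>2) / ln (real n))"

(* Sequences are indexed from 1; the value a 0 is never used. *)
definition roth_szekeres :: "(nat \<Rightarrow> nat) \<Rightarrow> bool" where
  "roth_szekeres a \<longleftrightarrow>
     (\<forall>n\<ge>1. a n > 0) \<and>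
     (\<forall>\<^sub>F n in sequentially. a (Suc n) \<ge> a n) \<and>
     (\<exists>s>0. (\<lambda>n. ln (real (a n)) / ln (real n)) \<longlonglongrightarrow> s) \<and>
     filterlim (rs_J a) at_top sequentially"

end

theory Submission
  imports Defs "HOL-Probability.Distributions" "HOL-Real_Asymp.Real_Asymp"
begin

text \<open>
  Near the origin, \<open>t \<le> \<pi> / (2 a\<^sub>n)\<close>, all factors \<open>cos (a\<^sub>i t)\<close> are nonnegative. There
  \<open>cos x = exp (- x\<^sup>2/2) g(x)\<close> with \<open>1 - x^4/12 - x^6 \<le> g(x) \<le> exp (- x^4/12) \<le> 1\<close>, and the
  Weierstrass inequality \<open>\<Prod> g\<^sub>i \<ge> 1 - \<Sum> (1 - g\<^sub>i)\<close> yields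
  \<open>\<Prod> cos (a\<^sub>i t) = exp (- A t\<^sup>2/2) (1 - B t^4/12)\<close> with \<open>A = \<Sum> a\<^sub>i\<^sup>2\<close>, \<open>B = \<Sum> a\<^sub>i^4\<close>, up to an
  error \<open>exp (- A t\<^sup>2/2) O(n a\<^sub>n^6 t^6 + n\<^sup>2 a\<^sub>n^8 t^8)\<close>. Beyond that range \<open>a\<^sub>n t \<ge> 1\<close>, so the same
  error term also dominates the tail of the Gaussian main term. Integrating over the whole
  half-line gives the two main terms and the error \<open>O(n a\<^sub>n^6 A\<^bsup>-7/2\<^esup> + n\<^sup>2 a\<^sub>n^8 A\<^bsup>-9/2\<^esup>)\<close>, which
  is as claimed because \<open>a\<^sub>n = n\<^bsup>s+o(1)\<^esup>\<close> and \<open>A = n\<^bsup>2s+1+o(1)\<^esup>\<close>. On the remaining range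
  \<open>\<bar>cos (\<pi> y)\<bar> \<le> exp (- 2 \<parallel>y\<parallel>\<^sup>2)\<close> and (C3) make the product smaller than any power of \<open>n\<close>.
\<close>

section \<open>Elementary bounds comparing the cosine with a Gaussian\<close>

lemma exp_minus_le_quadratic:
  fixes y :: real
  assumes "0 \<le> y"
  shows "exp (- y) \<le> 1 - y + y\<^sup>2 / 2"
proof -
  have "(\<lambda>y. 1 - y + y\<^sup>2 / 2 - exp (- y)) 0 \<le> (\<lambda>y::real. 1 - y + y\<^sup>2 / 2 - exp (- y)) y"
  proof (rule DERIV_nonneg_imp_nondecreasing[OF assms])
    fix x :: real
    have "((\<lambda>y. 1 - y + y\<^sup>2 / 2 - exp (- y)) has_real_derivative (x - 1 + exp (- x))) (at x)"
      by (auto intro!: derivative_eq_intros)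
    moreover have "x - 1 + exp (- x) \<ge> 0"
      using exp_ge_add_one_self[of "- x"] by linarith
    ultimately show "\<exists>d. ((\<lambda>y. 1 - y + y\<^sup>2 / 2 - exp (- y)) has_real_derivative d) (at x) \<and> 0 \<le> d"
      by blast
  qed
  then show ?thesis by simp
qed

lemma mult_cos_le_sin:
  fixes x :: real
  assumes "0 \<le> x" "x \<le> pi / 2"
  shows "x * cos x \<le> sin x"
proof -
  have "(\<lambda>x. sin x - x * cos x) 0 \<le> (\<lambda>x. sin x - x * cos x) x"
  proof (rule DERIV_nonneg_imp_nondecreasing[OF assms(1)])
    fix z assume z: "0 \<le> z" "z \<le> x"
    have "((\<lambda>x. sin x - x * cos x) has_real_derivative (z * sin z)) (at z)"
      by (auto intro!: derivative_eq_intros)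
    moreover have "0 \<le> z * sin z"
      using z assms by (intro mult_nonneg_nonneg sin_ge_zero) auto
    ultimately show "\<exists>d. ((\<lambda>x. sin x - x * cos x) has_real_derivative d) (at z) \<and> 0 \<le> d"
      by blast
  qed
  then show ?thesis by simp
qed

text \<open>This is \<open>tan x \<ge> x + x ^ 3 / 3\<close> with the denominator cleared, so that
  \<open>pi / 2\<close> is included. The derivative of the difference is nonnegative by the linear
  version \<open>mult_cos_le_sin\<close>.\<close>

lemma cubic_mult_cos_le_sin:
  fixes x :: real
  assumes "0 \<le> x" "x \<le> pi / 2"
  shows "(x + x ^ 3 / 3) * cos x \<le> sin x"
proof -
  let ?f = "\<lambda>x::real. sin x - (x + x ^ 3 / 3) * cos x"
  have "?f 0 \<le> ?f x"
  proof (rule DERIV_nonneg_imp_nondecreasing[OF assms(1)])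
    fix z assume z: "0 \<le> z" "z \<le> x"
    have "(?f has_real_derivative (z * (sin z - z * cos z) + z ^ 3 / 3 * sin z)) (at z)"
      by (auto intro!: derivative_eq_intros simp: field_simps power2_eq_square power3_eq_cube)
    moreover have "0 \<le> z * (sin z - z * cos z) + z ^ 3 / 3 * sin z"
      using z assms mult_cos_le_sin[of z]
      by (intro add_nonneg_nonneg mult_nonneg_nonneg sin_ge_zero) auto
    ultimately show "\<exists>d. (?f has_real_derivative d) (at z) \<and> 0 \<le> d"
      by blast
  qed
  then show ?thesis by simp
qed

text \<open>The exponent consists of the first two terms of the expansion of
  \<open>- ln (cos x)\<close>. After moving the exponentials to the left, the logarithmic derivative
  is \<open>x + x ^ 3 / 3 - tan x\<close>, which is nonpositive by the preceding lemma.\<close>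

lemma cos_le_exp_quartic:
  fixes x :: real
  assumes "0 \<le> x" "x \<le> pi / 2"
  shows "cos x \<le> exp (- (x\<^sup>2 / 2)) * exp (- (x ^ 4 / 12))"
proof -
  let ?f = "\<lambda>x::real. cos x * exp (x\<^sup>2 / 2 + x ^ 4 / 12)"
  have "?f x \<le> ?f 0"
  proof (rule DERIV_nonpos_imp_nonincreasing[OF assms(1)])
    fix z assume z: "0 \<le> z" "z \<le> x"
    have "(?f has_real_derivative
        (((z + z ^ 3 / 3) * cos z - sin z) * exp (z\<^sup>2 / 2 + z ^ 4 / 12))) (at z)"
      by (auto intro!: derivative_eq_intros simp: algebra_simps)
    moreover have "((z + z ^ 3 / 3) * cos z - sin z) * exp (z\<^sup>2 / 2 + z ^ 4 / 12) \<le> 0"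
      using z assms cubic_mult_cos_le_sin[of z]
      by (intro mult_nonpos_nonneg) auto
    ultimately show "\<exists>d. (?f has_real_derivative d) (at z) \<and> d \<le> 0"
      by blast
  qed
  then have "cos x * exp (x\<^sup>2 / 2 + x ^ 4 / 12) \<le> 1" by simp
  then have "cos x \<le> exp (- (x\<^sup>2 / 2 + x ^ 4 / 12))"
    by (simp add: exp_minus field_simps)
  then show ?thesis by (simp add: exp_add [symmetric])
qed

lemma cos_ge_Taylor6:
  fixes x :: real
  shows "1 - x\<^sup>2 / 2 + x ^ 4 / 24 - x ^ 6 / 720 \<le> cos x"
proof -
  obtain t where t: "cos x = (\<Sum>m<6. cos_coeff m * x ^ m) + (cos (t + 1/2 * real 6 * pi) / fact 6) * x ^ 6"
    using Maclaurin_cos_expansion[of x 6] by blast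
  have "(\<Sum>m<6. cos_coeff m * x ^ m) = 1 - x\<^sup>2 / 2 + x ^ 4 / 24"
  proof -
    have "{..<6} = {0, 1, 2, 3, 4, 5::nat}" by auto
    then show ?thesis by (simp add: cos_coeff_def fact_numeral)
  qed
  moreover have "(-1 / 720) * x ^ 6 \<le> (cos (t + 1/2 * real 6 * pi) / fact 6) * x ^ 6"
    using cos_ge_minus_one[of "t + 1/2 * real 6 * pi"]
    by (intro mult_right_mono zero_le_even_power) (auto simp: fact_numeral field_simps)
  ultimately show ?thesis using t by simp
qed

text \<open>If the polynomial factor is negative, \<open>cos x \<ge> 0\<close> suffices. Otherwise
  \<open>x \<le> 1\<close>, and in \<open>y = x^2\<close> the claim reduces to comparing
  polynomials: the product agrees with the cosine series through \<open>y^2\<close>, so only the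
  \<open>y^3\<close> term has to be controlled.\<close>

lemma cos_ge_gauss_quartic:
  fixes x :: real
  assumes "0 \<le> x" "x \<le> pi / 2"
  shows "exp (- (x\<^sup>2 / 2)) * (1 - x ^ 4 / 12 - x ^ 6) \<le> cos x"
proof (cases "1 - x ^ 4 / 12 - x ^ 6 \<ge> 0")
  case True
  have "x ^ 6 \<le> 1"
    using True zero_le_power[OF assms(1), of 4] by linarith
  then have x1: "x \<le> 1"
    using power_mono_iff[OF assms(1), of 1 6] by simp
  define y where "y = x\<^sup>2"
  have y: "0 \<le> y" "y \<le> 1" "x ^ 4 = y\<^sup>2" "x ^ 6 = y ^ 3"
    using x1 assms(1) by (auto simp: y_def power_le_one power_mult [symmetric])
  have "exp (- (y / 2)) * (1 - y\<^sup>2 / 12 - y ^ 3) \<le> (1 - y / 2 + y\<^sup>2 / 8) * (1 - y\<^sup>2 / 12 - y ^ 3)"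
    using exp_minus_le_quadratic[of "y / 2"] True y
    by (intro mult_right_mono) (auto simp: power2_eq_square)
  also have "\<dots> = 1 - y / 2 + y\<^sup>2 / 24 - y ^ 3 * (23 / 24 - y / 2 + y / 96 + y\<^sup>2 / 8)"
    by (simp add: field_simps power2_eq_square power3_eq_cube)
  also have "\<dots> \<le> 1 - y / 2 + y\<^sup>2 / 24 - y ^ 3 * (1 / 720)"
  proof -
    have "0 \<le> y\<^sup>2" by simp
    \<comment> \<open>For \<open>y\<close> in [0,1] the right-hand side is at least 23/24 - 1/2 =
      11/24.\<close>
    then have "1 / 720 \<le> 23 / 24 - y / 2 + y / 96 + y\<^sup>2 / 8" using y by linarith
    then have "y ^ 3 * (1 / 720) \<le> y ^ 3 * (23 / 24 - y / 2 + y / 96 + y\<^sup>2 / 8)"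
      using y by (intro mult_left_mono) auto
    then show ?thesis by linarith
  qed
  also have "\<dots> \<le> cos x"
    using cos_ge_Taylor6[of x] unfolding y(3,4) y_def[symmetric] by simp
  finally show ?thesis unfolding y(3,4) y_def[symmetric] .
next
  case False
  then have "exp (- (x\<^sup>2 / 2)) * (1 - x ^ 4 / 12 - x ^ 6) \<le> 0"
    by (intro mult_nonneg_nonpos) auto
  also have "0 \<le> cos x" using assms by (intro cos_ge_zero) auto
  finally show ?thesis .
qed

text \<open>Up to sign the cosine has period \<open>pi\<close>, so \<open>y\<close> may be shifted
  into [-1/2, 1/2]. There the quartic factor of \<open>cos_le_exp_quartic\<close> is dropped, and
  \<open>pi \<ge> 2\<close> gives the constant 2 = 2^2/2.\<close>

lemma abs_cos_pi_le_exp_dist_int: "\<bar>cos (pi * y)\<bar> \<le> exp (- 2 * (dist_int y)\<^sup>2)"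
proof -
  define z where "z = y - of_int (round y)"
  have z: "\<bar>z\<bar> \<le> 1 / 2" "dist_int y = \<bar>z\<bar>"
    using of_int_round_abs_le[of y] by (auto simp: z_def dist_int_def abs_minus_commute)
  have "\<bar>cos (pi * y)\<bar> = \<bar>cos (pi * z + pi * of_int (round y))\<bar>"
    by (simp add: z_def algebra_simps)
  also have "\<dots> = \<bar>cos (pi * z)\<bar>"
    by (simp only: cos_add sin_npi_int cos_npi_int) simp
  also have "\<dots> = \<bar>cos (pi * \<bar>z\<bar>)\<bar>"
    by (simp add: abs_if)
  also have "\<dots> = cos (pi * \<bar>z\<bar>)"
    using z(1) pi_gt_zero by (intro abs_of_nonneg cos_ge_zero) (auto simp: field_simps intro: order_trans[of _ 0])
  also have "\<dots> \<le> exp (- ((pi * \<bar>z\<bar>)\<^sup>2 / 2)) * exp (- ((pi * \<bar>z\<bar>) ^ 4 / 12))"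
    using z(1) by (intro cos_le_exp_quartic) (auto simp: field_simps)
  also have "\<dots> \<le> exp (- ((pi * \<bar>z\<bar>)\<^sup>2 / 2)) * 1"
    by (intro mult_left_mono) auto
  also have "\<dots> \<le> exp (- 2 * (dist_int y)\<^sup>2)"
  proof -
    have "2\<^sup>2 * z\<^sup>2 \<le> pi\<^sup>2 * z\<^sup>2"
      using pi_ge_two by (intro mult_right_mono power_mono) auto
    then show ?thesis by (simp add: z power_mult_distrib)
  qed
  finally show ?thesis .
qed

section \<open>Even moments of a Gaussian on the half-line\<close>

lemma has_bochner_integral_lborel_imp_has_integral:
  fixes f :: "'a::euclidean_space \<Rightarrow> 'b::euclidean_space"
  assumes "has_bochner_integral lborel f i"
  shows "(f has_integral i) UNIV"
  using assms has_integral_integral_lborel[of f] by (simp add: has_bochner_integral_iff)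

text \<open>Substituting \<open>c * x\<close> with \<open>c = sqrt (A / 2)\<close> in the moments of
  \<open>exp (- x^2)\<close> gives this. The quotient of factorials is the double factorial
  (2k-1)!!, that is 1, 3, 15, 105 for k = 0, 2, 3, 4.\<close>

lemma has_integral_gauss_even_moment:
  fixes A :: real and k :: nat
  assumes "A > 0"
  shows "((\<lambda>t. exp (- (A * t\<^sup>2 / 2)) * t ^ (2 * k)) has_integral
           sqrt (2 * pi) / 2 * (fact (2 * k) / (2 ^ k * fact k)) * A powr (- (real k + 1/2))) {0..}"
proof -
  define c where "c = sqrt (A / 2)"
  have c: "c > 0" "c\<^sup>2 = A / 2" using assms by (auto simp: c_def)
  define M where "M = sqrt pi / 2 * (fact (2 * k) / (2 ^ (2 * k) * fact k))"
  have "has_bochner_integral lborel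
      (\<lambda>x. indicator {0..} (0 + c * x) *\<^sub>R (exp (- (0 + c * x)\<^sup>2) * (0 + c * x) ^ (2 * k))) (M /\<^sub>R \<bar>c\<bar>)"
    using gaussian_moment_even_pos[of k] c
      lborel_has_bochner_integral_real_affine_iff[of c
        "\<lambda>x. indicator {0..} x *\<^sub>R (exp (- x\<^sup>2) * x ^ (2 * k))" M 0]
    by (simp add: M_def)
  then have "((\<lambda>x. indicator {0..} (0 + c * x) *\<^sub>R (exp (- (0 + c * x)\<^sup>2) * (0 + c * x) ^ (2 * k)))
      has_integral (M /\<^sub>R \<bar>c\<bar>)) UNIV"
    by (rule has_bochner_integral_lborel_imp_has_integral)
  moreover have "(\<lambda>x. indicator {0..} (0 + c * x) *\<^sub>R (exp (- (0 + c * x)\<^sup>2) * (0 + c * x) ^ (2 * k)))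
      = (\<lambda>x. if x \<in> {0..} then exp (- (A * x\<^sup>2 / 2)) * ((A / 2) ^ k * x ^ (2 * k)) else 0)"
  proof -
    have "(c * x) ^ (2 * k) = (A / 2) ^ k * x ^ (2 * k)" for x
      by (simp only: power_mult_distrib power_mult c(2))
    moreover have "(c * x)\<^sup>2 = A * x\<^sup>2 / 2" for x
      by (simp add: power_mult_distrib c(2))
    ultimately show ?thesis
      using c by (simp add: fun_eq_iff indicator_def zero_le_mult_iff)
  qed
  ultimately have "((\<lambda>x. exp (- (A * x\<^sup>2 / 2)) * ((A / 2) ^ k * x ^ (2 * k))) has_integral (M / c)) {0..}"
    using c by (simp only: has_integral_restrict_UNIV abs_of_pos real_scaleR_def
        divide_inverse mult.commute[of M])
  then have "((\<lambda>x. inverse ((A / 2) ^ k) * (exp (- (A * x\<^sup>2 / 2)) * ((A / 2) ^ k * x ^ (2 * k))))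
      has_integral (inverse ((A / 2) ^ k) * (M / c))) {0..}"
    by (rule has_integral_mult_right)
  moreover have "inverse ((A / 2) ^ k) * (M / c) =
      sqrt (2 * pi) / 2 * (fact (2 * k) / (2 ^ k * fact k)) * A powr (- (real k + 1/2))"
  proof -
    have e1: "A powr (- (real k + 1/2)) = inverse (A ^ k * sqrt A)"
      using assms by (simp only: powr_minus powr_add powr_half_sqrt powr_realpow)
    have e2: "sqrt pi / c = sqrt (2 * pi) / sqrt A"
      by (simp add: c_def real_sqrt_divide real_sqrt_mult)
    have e3: "inverse ((A / 2) ^ k) = 2 ^ k / A ^ k"
      by (simp add: power_divide)
    have "(2::real) ^ (2 * k) = 2 ^ k * 2 ^ k"
      by (simp only: mult_2 power_add)
    then have e4: "M / c = sqrt pi / c / 2 * (fact (2 * k) / (2 ^ k * 2 ^ k * fact k))"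
      by (simp only: M_def) simp
    show ?thesis
      unfolding e1 e2 e3 e4 using assms by (simp add: field_simps)
  qed
  moreover have "inverse ((A / 2) ^ k) * (exp (- (A * x\<^sup>2 / 2)) * ((A / 2) ^ k * x ^ (2 * k)))
      = exp (- (A * x\<^sup>2 / 2)) * x ^ (2 * k)" for x
    using assms by simp
  ultimately show ?thesis by simp
qed

section \<open>The cosine product near the origin\<close>

text \<open>The lower bound applies the Weierstrass inequality to the deficits \<open>f i\<close> of
  the quotients of cosine and Gaussian. The upper bound multiplies \<open>cos_le_exp_quartic\<close>
  over \<open>I\<close> and then expands the exponential of the quartic sum to second order, whence
  288 = 2 * 12^2.\<close>

lemma prod_cos_gauss_bounds:
  fixes x :: "'i \<Rightarrow> real"
  assumes x: "\<And>i. i \<in> I \<Longrightarrow> 0 \<le> x i" "\<And>i. i \<in> I \<Longrightarrow> x i \<le> pi / 2"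
  shows "exp (- ((\<Sum>i\<in>I. (x i)\<^sup>2) / 2)) * (1 - (\<Sum>i\<in>I. x i ^ 4) / 12 - (\<Sum>i\<in>I. x i ^ 6))
           \<le> (\<Prod>i\<in>I. cos (x i))" (is ?lower)
    and "(\<Prod>i\<in>I. cos (x i)) \<le> exp (- ((\<Sum>i\<in>I. (x i)\<^sup>2) / 2)) *
           (1 - (\<Sum>i\<in>I. x i ^ 4) / 12 + (\<Sum>i\<in>I. x i ^ 4)\<^sup>2 / 288)" (is ?upper)
proof -
  \<comment> \<open>For infinite \<open>I\<close> the product and the sum take the default values 1
    and 0, so both sides equal 1.\<close>
  have exp_sum': "(\<Prod>i\<in>I. exp (f i)) = exp (\<Sum>i\<in>I. f i)" for f :: "'i \<Rightarrow> real"
    by (cases "finite I") (simp_all add: exp_sum)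
  define f where "f i = 1 - cos (x i) * exp ((x i)\<^sup>2 / 2)" for i
  have f_le: "f i \<le> x i ^ 4 / 12 + x i ^ 6" if "i \<in> I" for i
  proof -
    have "(1 - x i ^ 4 / 12 - x i ^ 6) = exp (- ((x i)\<^sup>2 / 2)) * (1 - x i ^ 4 / 12 - x i ^ 6) * exp ((x i)\<^sup>2 / 2)"
      by (simp add: exp_minus)
    also have "\<dots> \<le> cos (x i) * exp ((x i)\<^sup>2 / 2)"
      using cos_ge_gauss_quartic[of "x i"] x that by (intro mult_right_mono) auto
    finally show ?thesis by (simp add: f_def)
  qed
  have f01: "f i \<in> {0..1}" if "i \<in> I" for i
  proof -
    have "cos (x i) * exp ((x i)\<^sup>2 / 2) \<le> exp (- ((x i)\<^sup>2 / 2)) * exp (- (x i ^ 4 / 12)) * exp ((x i)\<^sup>2 / 2)"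
      using cos_le_exp_quartic[of "x i"] x that by (intro mult_right_mono) auto
    also have "\<dots> = exp (- (x i ^ 4 / 12))" by (simp add: exp_minus)
    also have "\<dots> \<le> 1" by simp
    finally have "0 \<le> f i" by (simp add: f_def)
    moreover have "0 \<le> cos (x i)"
      using x that pi_gt_zero by (intro cos_ge_zero) (auto intro: order_trans[of _ 0])
    ultimately show ?thesis by (simp add: f_def)
  qed
  have "1 - (\<Sum>i\<in>I. x i ^ 4) / 12 - (\<Sum>i\<in>I. x i ^ 6) = 1 - (\<Sum>i\<in>I. x i ^ 4 / 12 + x i ^ 6)"
    by (simp add: sum.distrib sum_divide_distrib)
  also have "\<dots> \<le> 1 - sum f I"
    by (intro diff_left_mono sum_mono f_le)
  also have "\<dots> \<le> (\<Prod>i\<in>I. 1 - f i)"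
    by (rule Weierstrass_prod_ineq) (rule f01)
  also have "\<dots> = (\<Prod>i\<in>I. cos (x i)) * exp ((\<Sum>i\<in>I. (x i)\<^sup>2) / 2)"
    by (simp add: f_def prod.distrib exp_sum' sum_divide_distrib)
  finally have "exp (- ((\<Sum>i\<in>I. (x i)\<^sup>2) / 2)) * (1 - (\<Sum>i\<in>I. x i ^ 4) / 12 - (\<Sum>i\<in>I. x i ^ 6))
      \<le> exp (- ((\<Sum>i\<in>I. (x i)\<^sup>2) / 2)) * ((\<Prod>i\<in>I. cos (x i)) * exp ((\<Sum>i\<in>I. (x i)\<^sup>2) / 2))"
    by (intro mult_left_mono) auto
  also have "\<dots> = (\<Prod>i\<in>I. cos (x i))"
    by (simp add: exp_minus)
  finally show ?lower .
  have "(\<Prod>i\<in>I. cos (x i)) \<le> (\<Prod>i\<in>I. exp (- ((x i)\<^sup>2 / 2)) * exp (- (x i ^ 4 / 12)))"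
    using x by (intro prod_mono conjI cos_ge_zero cos_le_exp_quartic)
      (auto intro: order_trans[of _ 0])
  also have "\<dots> = exp (- ((\<Sum>i\<in>I. (x i)\<^sup>2) / 2)) * exp (- ((\<Sum>i\<in>I. x i ^ 4) / 12))"
    by (simp add: prod.distrib exp_sum' sum_divide_distrib sum_negf)
  also have "\<dots> \<le> exp (- ((\<Sum>i\<in>I. (x i)\<^sup>2) / 2)) *
      (1 - (\<Sum>i\<in>I. x i ^ 4) / 12 + ((\<Sum>i\<in>I. x i ^ 4) / 12)\<^sup>2 / 2)"
    using x by (intro mult_left_mono exp_minus_le_quadratic divide_nonneg_nonneg sum_nonneg) auto
  finally show ?upper by (simp add: power_divide)
qed

text \<open>The product, extended by zero beyond \<open>T = pi / (2 * m)\<close>, is compared with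
  the main term \<open>G\<close> on the whole half-line, where all integrals are exact Gaussian
  moments. A single error function \<open>E\<close> serves both ranges of \<open>t\<close>.\<close>

lemma integral_prod_cos_near_zero:
  fixes b :: "'i \<Rightarrow> real" and m :: real
  assumes I: "finite I" "I \<noteq> {}" and b: "\<And>i. i \<in> I \<Longrightarrow> 0 < b i" "\<And>i. i \<in> I \<Longrightarrow> b i \<le> m"
  defines "A \<equiv> \<Sum>i\<in>I. (b i)\<^sup>2" and "B \<equiv> \<Sum>i\<in>I. b i ^ 4" and "N \<equiv> real (card I)"
  shows "\<bar>integral {0..pi / (2 * m)} (\<lambda>t. \<Prod>i\<in>I. cos (b i * t))
            - (1/2 * sqrt (2 * pi / A) - sqrt (2 * pi) * B / (8 * A powr (5/2)))\<bar>
         \<le> sqrt (2 * pi) * (15 * N * m ^ 6 * A powr (-(7/2)) + N\<^sup>2 * m ^ 8 * A powr (-(9/2)))"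
proof -
  have m: "m > 0" using I b by fastforce
  have A: "A > 0" unfolding A_def using I b by (intro sum_pos zero_less_power)
  have N: "N \<ge> 1" unfolding N_def using I by (simp add: card_gt_0_iff Suc_le_eq)
  have B: "0 \<le> B" "B \<le> N * m ^ 4"
    unfolding B_def N_def using b by (auto intro!: sum_nonneg sum_bounded_above power_mono simp: less_imp_le)
  define T where "T = pi / (2 * m)"
  define P where "P t = (\<Prod>i\<in>I. cos (b i * t))" for t
  define G where "G t = exp (- (A * t\<^sup>2 / 2)) * (1 - B * t ^ 4 / 12)" for t
  \<comment> \<open>One \<open>N * m ^ 6 * t ^ 6\<close> would do up to \<open>T\<close>; the factor
    2 makes room for the two summands that bound \<open>G\<close> beyond \<open>T\<close>. The 1/288
    is that of the upper product bound.\<close>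
  define E where "E t = exp (- (A * t\<^sup>2 / 2)) * (2 * N * m ^ 6 * t ^ 6 + N\<^sup>2 * m ^ 8 * t ^ 8 / 288)" for t
  define f where "f t = (if t \<in> {0..T} then P t else 0)" for t
  have "(P has_integral integral {0..T} P) {0..T}"
    unfolding P_def by (intro integrable_integral integrable_continuous_real continuous_intros)
  then have f: "(f has_integral integral {0..T} P) {0..}"
    unfolding f_def by (subst has_integral_restrict) auto
  note M = has_integral_gauss_even_moment[OF A]
  \<comment> \<open>The moments of order 0 and 4 yield the two main terms; the coefficient 1/8 is 3
    / (12 * 2).\<close>
  have "((\<lambda>t. exp (- (A * t\<^sup>2 / 2)) * t ^ (2 * 0) - B / 12 * (exp (- (A * t\<^sup>2 / 2)) * t ^ (2 * 2))) has_integral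
      (sqrt (2 * pi) / 2 * A powr (-(1/2)) - B / 12 * (sqrt (2 * pi) / 2 * 3 * A powr (-(5/2))))) {0..}"
    using M[of 0] M[of 2] by (intro has_integral_diff has_integral_mult_right) (auto simp: fact_numeral)
  also have "(\<lambda>t. exp (- (A * t\<^sup>2 / 2)) * t ^ (2 * 0) - B / 12 * (exp (- (A * t\<^sup>2 / 2)) * t ^ (2 * 2))) = G"
    by (simp add: G_def fun_eq_iff algebra_simps)
  also have "sqrt (2 * pi) / 2 * A powr (-(1/2)) - B / 12 * (sqrt (2 * pi) / 2 * 3 * A powr (-(5/2)))
      = 1/2 * sqrt (2 * pi / A) - sqrt (2 * pi) * B / (8 * A powr (5/2))"
    using A by (simp add: powr_minus powr_half_sqrt real_sqrt_divide field_simps)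
  finally have G: "(G has_integral (1/2 * sqrt (2 * pi / A) - sqrt (2 * pi) * B / (8 * A powr (5/2)))) {0..}" .
  have "((\<lambda>t. 2 * N * m ^ 6 * (exp (- (A * t\<^sup>2 / 2)) * t ^ (2 * 3)) + N\<^sup>2 * m ^ 8 / 288 * (exp (- (A * t\<^sup>2 / 2)) * t ^ (2 * 4))) has_integral
      (2 * N * m ^ 6 * (sqrt (2 * pi) / 2 * 15 * A powr (-(7/2))) + N\<^sup>2 * m ^ 8 / 288 * (sqrt (2 * pi) / 2 * 105 * A powr (-(9/2))))) {0..}"
    using M[of 3] M[of 4] by (intro has_integral_add has_integral_mult_right) (auto simp: fact_numeral)
  also have "(\<lambda>t. 2 * N * m ^ 6 * (exp (- (A * t\<^sup>2 / 2)) * t ^ (2 * 3)) + N\<^sup>2 * m ^ 8 / 288 * (exp (- (A * t\<^sup>2 / 2)) * t ^ (2 * 4))) = E"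
    by (simp add: E_def fun_eq_iff algebra_simps)
  finally have E: "(E has_integral
      (2 * N * m ^ 6 * (sqrt (2 * pi) / 2 * 15 * A powr (-(7/2))) + N\<^sup>2 * m ^ 8 / 288 * (sqrt (2 * pi) / 2 * 105 * A powr (-(9/2))))) {0..}" .
  have bound: "norm (f t - G t) \<le> E t" if t: "t \<in> {0..}" for t
  proof (cases "t \<le> T")
    case True
    have x: "0 \<le> b i * t" "b i * t \<le> pi / 2" "b i * t \<le> m * t" if "i \<in> I" for i
    proof -
      show "0 \<le> b i * t"
        using t b(1)[OF that] by simp
      show "b i * t \<le> m * t"
        using t b(2)[OF that] by (auto intro: mult_right_mono)
      also have "m * t \<le> m * T" using m True by simp
      also have "\<dots> = pi / 2" using m by (simp add: T_def)
      finally show "b i * t \<le> pi / 2" by simp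
    qed
    have sums: "(\<Sum>i\<in>I. (b i * t)\<^sup>2) = A * t\<^sup>2" "(\<Sum>i\<in>I. (b i * t) ^ 4) = B * t ^ 4"
      by (simp_all add: A_def B_def power_mult_distrib sum_distrib_right)
    have C: "(\<Sum>i\<in>I. (b i * t) ^ 6) \<le> N * (m * t) ^ 6"
      unfolding N_def using x by (intro sum_bounded_above power_mono) auto
    have "(B * t ^ 4)\<^sup>2 \<le> (N * m ^ 4 * t ^ 4)\<^sup>2"
      using B t by (intro power_mono mult_right_mono mult_nonneg_nonneg) auto
    also have "\<dots> = N\<^sup>2 * m ^ 8 * t ^ 8"
      by (simp add: power_mult_distrib)
    finally have D: "(B * t ^ 4)\<^sup>2 \<le> N\<^sup>2 * m ^ 8 * t ^ 8" .
    have pos: "0 \<le> N * m ^ 6 * t ^ 6" "0 \<le> N\<^sup>2 * m ^ 8 * t ^ 8"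
      using N m t by auto
    note bounds = prod_cos_gauss_bounds[of I "\<lambda>i. b i * t", OF x(1,2), unfolded sums, folded P_def]
    let ?e = "exp (- (A * t\<^sup>2 / 2))"
    have "P t - G t \<le> ?e * ((B * t ^ 4)\<^sup>2 / 288)"
      using bounds(2) unfolding G_def
      by (simp add: algebra_simps)
    also have "\<dots> \<le> E t"
      unfolding E_def using D pos by (intro mult_left_mono) (linarith, simp)
    finally have u: "P t - G t \<le> E t" .
    have "G t - P t \<le> ?e * (\<Sum>i\<in>I. (b i * t) ^ 6)"
      using bounds(1) unfolding G_def
      by (simp add: algebra_simps)
    also have "\<dots> \<le> E t"
    proof -
      have "(\<Sum>i\<in>I. (b i * t) ^ 6) \<le> N * m ^ 6 * t ^ 6"
        using C by (simp add: power_mult_distrib)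
      then show ?thesis unfolding E_def using pos by (intro mult_left_mono) (linarith, simp)
    qed
    finally have "G t - P t \<le> E t" .
    with u show ?thesis using t True by (simp add: f_def abs_le_iff)
  next
    case False
    \<comment> \<open>Beyond \<open>T\<close> the product is replaced by 0, and
      \<open>m * t \<ge> 1\<close> lets the sixth power absorb the lower powers in
      \<open>G\<close>.\<close>
    have "1 \<le> pi / 2" using pi_ge_two by simp
    also have "pi / 2 = m * T" using m by (simp add: T_def)
    also have "\<dots> \<le> m * t" using m False by simp
    finally have mt: "1 \<le> m * t" .
    have "\<bar>1 - B * t ^ 4 / 12\<bar> \<le> 1 + B * t ^ 4"
    proof -
      have "0 \<le> B * t ^ 4" using B t by simp
      then show ?thesis by (simp only: abs_le_iff) linarith
    qed
    also have "\<dots> \<le> 1 + N * m ^ 4 * t ^ 4"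
      using B t by (intro add_left_mono mult_right_mono) auto
    also have "\<dots> \<le> N * (m * t) ^ 6 + N * (m * t) ^ 6"
    proof (rule add_mono)
      show "1 \<le> N * (m * t) ^ 6"
        using mult_mono[OF N one_le_power[OF mt, of 6]] N by simp
      show "N * m ^ 4 * t ^ 4 \<le> N * (m * t) ^ 6"
        using power_increasing[OF _ mt, of 4 6] N by (simp add: power_mult_distrib)
    qed
    also have "\<dots> \<le> 2 * N * m ^ 6 * t ^ 6 + N\<^sup>2 * m ^ 8 * t ^ 8 / 288"
      using N m t by (simp add: power_mult_distrib)
    finally have "\<bar>G t\<bar> \<le> E t"
      unfolding G_def E_def abs_mult by (intro mult_mono) auto
    then show ?thesis using False by (simp add: f_def)
  qed
  have "norm (integral {0..T} P - (1/2 * sqrt (2 * pi / A) - sqrt (2 * pi) * B / (8 * A powr (5/2))))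
      \<le> 2 * N * m ^ 6 * (sqrt (2 * pi) / 2 * 15 * A powr (-(7/2))) + N\<^sup>2 * m ^ 8 / 288 * (sqrt (2 * pi) / 2 * 105 * A powr (-(9/2)))"
    using has_integral_norm_bound_integral_component[OF has_integral_diff[OF f G] E, of 1] bound by simp
  also have "\<dots> = sqrt (2 * pi) * (15 * N * m ^ 6 * A powr (-(7/2)) + 105 / 576 * (N\<^sup>2 * m ^ 8 * A powr (-(9/2))))"
    by (simp add: algebra_simps)
  also have "\<dots> \<le> sqrt (2 * pi) * (15 * N * m ^ 6 * A powr (-(7/2)) + N\<^sup>2 * m ^ 8 * A powr (-(9/2)))"
    using m by (intro mult_left_mono add_left_mono) auto
  finally show ?thesis unfolding T_def P_def real_norm_def .
qed

section \<open>The range away from the origin\<close>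

text \<open>Multiplying \<open>abs_cos_pi_le_exp_dist_int\<close> over \<open>i\<close> produces
  exactly the sum whose infimum, divided by \<open>ln n\<close>, is \<open>rs_J a n\<close>.\<close>

lemma abs_prod_cos_le_powr_rs_J:
  assumes n: "n \<ge> 2" and u: "u \<in> {1 / (2 * real (a n)) <.. 1/2}"
  shows "\<bar>\<Prod>i=1..n. cos (real (a i) * (pi * u))\<bar> \<le> real n powr (- 2 * rs_J a n)"
proof -
  let ?d = "\<lambda>t. \<Sum>i=1..n. (dist_int (real (a i) * t))\<^sup>2"
  have ln: "ln (real n) > 0" using n by simp
  have "rs_J a n \<le> ?d u / ln (real n)"
    unfolding rs_J_def using ln
    by (intro cINF_lower[OF _ u] bdd_belowI2[where m = 0]) (auto intro!: divide_nonneg_nonneg sum_nonneg)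
  then have J: "rs_J a n * ln (real n) \<le> ?d u"
    using ln by (simp add: field_simps)
  have "\<bar>\<Prod>i=1..n. cos (real (a i) * (pi * u))\<bar> = (\<Prod>i=1..n. \<bar>cos (pi * (real (a i) * u))\<bar>)"
    by (simp add: abs_prod mult_ac)
  also have "\<dots> \<le> (\<Prod>i=1..n. exp (- 2 * (dist_int (real (a i) * u))\<^sup>2))"
    using abs_cos_pi_le_exp_dist_int by (intro prod_mono) simp
  also have "\<dots> = exp (- 2 * ?d u)"
    by (simp only: exp_sum[OF finite_atLeastAtMost, symmetric] sum_distrib_left)
  also have "\<dots> \<le> exp (- 2 * (rs_J a n * ln (real n)))"
    using J by simp
  also have "\<dots> = real n powr (- 2 * rs_J a n)"
    using n by (simp add: powr_def mult_ac)
  finally show ?thesis .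
qed

lemma abs_integral_prod_cos_tail_le:
  assumes n: "n \<ge> 2" and a: "a n > 0"
  shows "\<bar>integral {pi / (2 * real (a n))..pi / 2} (\<lambda>t. \<Prod>i=1..n. cos (real (a i) * t))\<bar>
           \<le> pi / 2 * real n powr (- 2 * rs_J a n)"
proof -
  define T where "T = pi / (2 * real (a n))"
  have T: "0 \<le> T" "T \<le> pi / 2"
    using a by (auto simp: T_def field_simps)
  let ?P = "\<lambda>t. \<Prod>i=1..n. cos (real (a i) * t)"
  have "norm (integral {T..pi / 2} ?P) \<le> real n powr (- 2 * rs_J a n) * measure lborel (cbox T (pi / 2))"
  proof (rule has_integral_bound_spike_finite[where S = "{T}"])
    show "(?P has_integral integral {T..pi / 2} ?P) (cbox T (pi / 2))"
      unfolding cbox_interval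
      by (intro integrable_integral integrable_continuous_real continuous_intros)
    fix t assume "t \<in> cbox T (pi / 2) - {T}"
    then have t: "T < t" "t \<le> pi / 2" by auto
    have "t / pi \<in> {1 / (2 * real (a n)) <.. 1/2}"
      using t a by (auto simp: T_def field_simps)
    from abs_prod_cos_le_powr_rs_J[of n "t / pi" a, OF n this]
    show "norm (?P t) \<le> real n powr (- 2 * rs_J a n)" by simp
  qed auto
  also have "\<dots> \<le> real n powr (- 2 * rs_J a n) * (pi / 2)"
    using T by (intro mult_left_mono) auto
  finally show ?thesis by (simp add: T_def mult.commute)
qed

section \<open>Growth of the sequence and of its sum of squares\<close>

lemma eventually_powr_bounds_of_ln_ratio:
  fixes f :: "nat \<Rightarrow> real"
  assumes lim: "(\<lambda>n. ln (f n) / ln (real n)) \<longlonglongrightarrow> s" and pos: "\<forall>\<^sub>F n in sequentially. f n > 0"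
    and "\<eta> > 0"
  shows "\<forall>\<^sub>F n in sequentially. real n powr (s - \<eta>) \<le> f n \<and> f n \<le> real n powr (s + \<eta>)"
proof -
  have "\<forall>\<^sub>F n in sequentially. ln (f n) / ln (real n) > s - \<eta>"
       "\<forall>\<^sub>F n in sequentially. ln (f n) / ln (real n) < s + \<eta>"
    using order_tendstoD[OF lim] \<open>\<eta> > 0\<close> by auto
  then show ?thesis
    using pos eventually_ge_at_top[of 2]
  proof eventually_elim
    case (elim n)
    have ln: "ln (real n) > 0" using elim by simp
    have "(s - \<eta>) * ln (real n) \<le> ln (f n)" "ln (f n) \<le> (s + \<eta>) * ln (real n)"
      using elim ln by (auto simp: field_simps)
    then have "exp ((s - \<eta>) * ln (real n)) \<le> exp (ln (f n))" "exp (ln (f n)) \<le> exp ((s + \<eta>) * ln (real n))"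
      by simp_all
    then show ?case using elim by (simp add: powr_def)
  qed
qed

text \<open>The upper half of the indices suffices: it has at least \<open>n / 2\<close> members,
  each contributing at least \<open>(n / 2) powr (2 * \<sigma>)\<close>.\<close>

lemma eventually_sum_squares_ge:
  fixes f :: "nat \<Rightarrow> real"
  assumes ev: "\<forall>\<^sub>F n in sequentially. real n powr \<sigma> \<le> f n" and "\<sigma> \<ge> 0"
  shows "\<forall>\<^sub>F n in sequentially. (real n / 2) powr (2 * \<sigma> + 1) \<le> (\<Sum>i=1..n. (f i)\<^sup>2)"
proof -
  obtain N where N: "\<And>n. n \<ge> N \<Longrightarrow> real n powr \<sigma> \<le> f n"
    using ev by (auto simp: eventually_sequentially)
  show ?thesis
    using eventually_ge_at_top[of "2 * N + 2"]
  proof eventually_elim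
    case (elim n)
    let ?I = "{n - n div 2..n}"
    have "(real n / 2) powr (2 * \<sigma> + 1) = real n / 2 * (real n / 2) powr (2 * \<sigma>)"
      using elim by (simp add: powr_add)
    also have "\<dots> \<le> real (card ?I) * (real n / 2) powr (2 * \<sigma>)"
    proof (rule mult_right_mono)
      have "n \<le> 2 * (n div 2 + 1)" by presburger
      then have "real n \<le> real (2 * (n div 2 + 1))" by (rule of_nat_mono)
      then show "real n / 2 \<le> real (card ?I)" by simp
    qed simp
    also have "\<dots> = (\<Sum>i\<in>?I. (real n / 2) powr (2 * \<sigma>))" by simp
    also have "\<dots> \<le> (\<Sum>i\<in>?I. (f i)\<^sup>2)"
    proof (rule sum_mono)
      fix i assume "i \<in> ?I"
      then have i: "n \<le> 2 * i" "N \<le> i" using elim by auto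
      have "real n \<le> real (2 * i)" using i(1) by (rule of_nat_mono)
      then have "(real n / 2) powr \<sigma> \<le> real i powr \<sigma>"
        using \<open>\<sigma> \<ge> 0\<close> by (intro powr_mono2) auto
      also have "\<dots> \<le> f i" using N i by simp
      finally have "((real n / 2) powr \<sigma>)\<^sup>2 \<le> (f i)\<^sup>2" by (intro power_mono) auto
      then show "(real n / 2) powr (2 * \<sigma>) \<le> (f i)\<^sup>2"
        by (simp only: mult_2 powr_add power2_eq_square)
    qed
    also have "\<dots> \<le> (\<Sum>i=1..n. (f i)\<^sup>2)"
      using elim by (intro sum_mono2) auto
    finally show ?case .
  qed
qed

text \<open>Divergence handles the finitely many indices before monotonicity sets in. This makes
  \<open>a n\<close> a valid choice of \<open>m\<close> in
  \<open>integral_prod_cos_near_zero\<close>.\<close>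

lemma eventually_last_is_max:
  fixes a :: "nat \<Rightarrow> 'a::linorder"
  assumes mono: "\<forall>\<^sub>F n in sequentially. a n \<le> a (Suc n)" and lim: "filterlim a at_top sequentially"
  shows "\<forall>\<^sub>F n in sequentially. \<forall>i\<le>n. a i \<le> a n"
proof -
  obtain N where N: "\<And>n. n \<ge> N \<Longrightarrow> a n \<le> a (Suc n)"
    using mono by (auto simp: eventually_sequentially)
  have "\<forall>\<^sub>F n in sequentially. Max (a ` {..N}) \<le> a n"
    using lim by (simp only: filterlim_at_top)
  then show ?thesis
  proof eventually_elim
    case (elim n)
    show ?case
    proof (intro allI impI)
      fix i assume i: "i \<le> n"
      show "a i \<le> a n"
      proof (cases "i \<le> N")
        case True
        then have "a i \<le> Max (a ` {..N})" by (intro Max_ge) auto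
        with elim show ?thesis by order
      next
        case False
        from i show ?thesis
        proof (induction n rule: dec_induct)
          case (step k)
          then show ?case using N[of k] False by (meson nat_le_linear order_trans)
        qed simp
      qed
    qed
  qed
qed

text \<open>Exponent bookkeeping for the two error terms near the origin, with
  \<open>x = a n\<close>, \<open>A\<close> the sum of squares and
  \<open>r = s + \<eta>\<close>.\<close>

lemma powr_product_bound:
  fixes n A x :: real and k :: nat
  assumes n: "n > 0" and A: "(n / 2) powr p \<le> A" and x: "0 \<le> x" "x \<le> n powr r" and q: "q \<ge> 0"
  shows "x ^ k * A powr (- q) \<le> 2 powr (p * q) * n powr (r * k - p * q)"
proof -
  have "A powr (- q) \<le> ((n / 2) powr p) powr (- q)"
    using n A q by (intro powr_mono2') auto
  also have "\<dots> = 2 powr (p * q) * n powr (- (p * q))"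
    using n by (simp add: powr_powr powr_divide powr_minus field_simps)
  finally have "x ^ k * A powr (- q) \<le> (n powr r) ^ k * (2 powr (p * q) * n powr (- (p * q)))"
    using x n by (intro mult_mono power_mono) auto
  also have "\<dots> = 2 powr (p * q) * n powr (r * k - p * q)"
    using n by (simp add: powr_power powr_diff powr_minus field_simps)
  finally show ?thesis .
qed

section \<open>Choice of the exponents and assembly of the two ranges\<close>

theorem theorem1:
  fixes a :: "nat \<Rightarrow> nat" and s \<epsilon> :: real
  assumes "roth_szekeres a"
    and "(\<lambda>n. ln (real (a n)) / ln (real n)) \<longlonglongrightarrow> s"
    and "\<epsilon> > 0"
  shows "(\<lambda>n. integral {0..pi/2} (\<lambda>t. \<Prod>i=1..n. cos (real (a i) * t))
            - (1/2 * sqrt (2 * pi / (\<Sum>i=1..n. (real (a i))\<^sup>2))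
               - sqrt (2 * pi) * (\<Sum>i=1..n. real (a i) ^ 4)
                   / (8 * (\<Sum>i=1..n. (real (a i))\<^sup>2) powr (5/2))))
         \<in> O[sequentially](\<lambda>n. real n powr (- s - 5/2 + \<epsilon>))"
proof -
  have pos: "a n > 0" if "n \<ge> 1" for n
    using assms(1) that by (simp add: roth_szekeres_def)
  have mono: "\<forall>\<^sub>F n in sequentially. a n \<le> a (Suc n)"
    and J: "filterlim (rs_J a) at_top sequentially"
    using assms(1) by (auto simp: roth_szekeres_def)
  have s: "s > 0"
    using assms(1,2) LIMSEQ_unique by (auto simp: roth_szekeres_def)
  have ev_pos: "\<forall>\<^sub>F n in sequentially. real (a n) > 0"
    using eventually_ge_at_top[of 1] by eventually_elim (use pos in auto)
  \<comment> \<open>The error terms will have exponents \<open>- s - 5/2\<close> plus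
    \<open>13 * \<eta>\<close> and \<open>17 * \<eta>\<close>, which requires
    \<open>17 * \<eta> \<le> \<epsilon>\<close>. The bound \<open>s / 2\<close> keeps
    \<open>s - \<eta>\<close> positive, so that \<open>a\<close> diverges.\<close>
  define \<eta> where "\<eta> = min (\<epsilon> / 17) (s / 2)"
  have \<eta>: "0 < \<eta>" "17 * \<eta> \<le> \<epsilon>" "\<eta> < s"
    using s \<open>\<epsilon> > 0\<close> by (auto simp: \<eta>_def)
  note growth = eventually_powr_bounds_of_ln_ratio[OF assms(2) ev_pos \<eta>(1)]
  have lower: "\<forall>\<^sub>F n in sequentially. real n powr (s - \<eta>) \<le> real (a n)"
    using growth by eventually_elim simp
  have "filterlim (\<lambda>n. real n powr (s - \<eta>)) at_top sequentially"
    using \<eta> by real_asymp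
  then have "filterlim (\<lambda>n. real (a n)) at_top sequentially"
    using lower by (rule filterlim_at_top_mono)
  then have "filterlim a at_top sequentially"
    by (simp add: filterlim_sequentially_iff_filterlim_real)
  note last_max = eventually_last_is_max[OF mono this]
  define p where "p = 2 * (s - \<eta>) + 1"
  have sum_lower: "\<forall>\<^sub>F n in sequentially. (real n / 2) powr p \<le> (\<Sum>i=1..n. (real (a i))\<^sup>2)"
    unfolding p_def using \<eta> by (intro eventually_sum_squares_ge[OF lower]) auto
  \<comment> \<open>This threshold makes \<open>n powr (- 2 * rs_J a n)\<close> at most
    \<open>n powr (- s - 5/2)\<close>.\<close>
  have J_large: "\<forall>\<^sub>F n in sequentially. (s + 5/2) / 2 \<le> rs_J a n"
    using J by (simp only: filterlim_at_top)
  define K where "K = sqrt (2 * pi) * (15 * 2 powr (p * (7/2)) + 2 powr (p * (9/2))) + pi / 2"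
  show ?thesis
  proof (rule bigoI[where c = K])
    show "\<forall>\<^sub>F n in sequentially. norm (integral {0..pi/2} (\<lambda>t. \<Prod>i=1..n. cos (real (a i) * t))
            - (1/2 * sqrt (2 * pi / (\<Sum>i=1..n. (real (a i))\<^sup>2))
               - sqrt (2 * pi) * (\<Sum>i=1..n. real (a i) ^ 4)
                   / (8 * (\<Sum>i=1..n. (real (a i))\<^sup>2) powr (5/2))))
         \<le> K * norm (real n powr (- s - 5/2 + \<epsilon>))"
      using growth last_max sum_lower J_large eventually_ge_at_top[of 2]
    proof eventually_elim
      case (elim n)
      define P where "P t = (\<Prod>i=1..n. cos (real (a i) * t))" for t
      define A where "A = (\<Sum>i=1..n. (real (a i))\<^sup>2)"
      define M where "M = 1/2 * sqrt (2 * pi / A) - sqrt (2 * pi) * (\<Sum>i=1..n. real (a i) ^ 4) / (8 * A powr (5/2))"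
      define T where "T = pi / (2 * real (a n))"
      define R where "R = real n powr (- s - 5/2 + \<epsilon>)"
      have an: "a n > 0" using elim pos by simp
      have n: "real n \<ge> 1" "real n > 0" using elim by auto
      have near: "\<bar>integral {0..T} P - M\<bar> \<le> sqrt (2 * pi) *
          (15 * n * real (a n) ^ 6 * A powr (-(7/2)) + (real n)\<^sup>2 * real (a n) ^ 8 * A powr (-(9/2)))"
        using integral_prod_cos_near_zero[of "{1..n}" "\<lambda>i. real (a i)" "real (a n)"] elim pos
        by (simp add: P_def[abs_def] A_def M_def T_def)
      have le_R: "real n powr e \<le> R" if "e \<le> - s - 5/2 + \<epsilon>" for e
        unfolding R_def using n that by (intro powr_mono) auto
      have Ap: "(real n / 2) powr p \<le> A" using elim by (simp add: A_def)
      have "n * (real (a n) ^ 6 * A powr (-(7/2)))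
          \<le> n * (2 powr (p * (7/2)) * real n powr ((s + \<eta>) * real 6 - p * (7/2)))"
        using elim n by (intro mult_left_mono powr_product_bound[OF n(2) Ap]) auto
      also have "\<dots> = 2 powr (p * (7/2)) * real n powr (1 + ((s + \<eta>) * real 6 - p * (7/2)))"
        using n by (simp only: powr_add) simp
      \<comment> \<open>The exponent is 1 + 6(s + \<eta>) - 7(s - \<eta>) - 7/2 = -s - 5/2 +
        13\<eta>.\<close>
      also have "\<dots> \<le> 2 powr (p * (7/2)) * R"
        using \<eta> by (intro mult_left_mono le_R) (auto simp: p_def field_simps)
      finally have t1: "n * (real (a n) ^ 6 * A powr (-(7/2))) \<le> 2 powr (p * (7/2)) * R" .
      have "(real n)\<^sup>2 * (real (a n) ^ 8 * A powr (-(9/2)))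
          \<le> (real n)\<^sup>2 * (2 powr (p * (9/2)) * real n powr ((s + \<eta>) * real 8 - p * (9/2)))"
        using elim n by (intro mult_left_mono powr_product_bound[OF n(2) Ap]) auto
      also have "\<dots> = 2 powr (p * (9/2)) * real n powr (2 + ((s + \<eta>) * real 8 - p * (9/2)))"
        using n by (simp only: powr_add) simp
      \<comment> \<open>Here it is 2 + 8(s + \<eta>) - 9(s - \<eta>) - 9/2 = -s - 5/2 + 17\<eta>,
        the binding case for \<eta>.\<close>
      also have "\<dots> \<le> 2 powr (p * (9/2)) * R"
        using \<eta> by (intro mult_left_mono le_R) (auto simp: p_def field_simps)
      finally have t2: "(real n)\<^sup>2 * (real (a n) ^ 8 * A powr (-(9/2))) \<le> 2 powr (p * (9/2)) * R" .
      have "15 * n * real (a n) ^ 6 * A powr (-(7/2)) + (real n)\<^sup>2 * real (a n) ^ 8 * A powr (-(9/2))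
          \<le> 15 * (2 powr (p * (7/2)) * R) + 2 powr (p * (9/2)) * R"
        using t1 t2 by (simp add: mult.assoc)
      then have near': "\<bar>integral {0..T} P - M\<bar> \<le> sqrt (2 * pi) * (15 * (2 powr (p * (7/2)) * R) + 2 powr (p * (9/2)) * R)"
        using order_trans[OF near mult_left_mono] by simp
      have "\<bar>integral {T..pi / 2} P\<bar> \<le> pi / 2 * real n powr (- 2 * rs_J a n)"
        using abs_integral_prod_cos_tail_le[of n a] elim an by (simp add: P_def[abs_def] T_def)
      also have "\<dots> \<le> pi / 2 * R"
        using elim \<open>\<epsilon> > 0\<close> by (intro mult_left_mono le_R) auto
      finally have far: "\<bar>integral {T..pi / 2} P\<bar> \<le> pi / 2 * R" .
      have "integral {0..T} P + integral {T..pi / 2} P = integral {0..pi / 2} P"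
      proof (rule Henstock_Kurzweil_Integration.integral_combine)
        show "0 \<le> T" "T \<le> pi / 2" using an by (auto simp: T_def field_simps)
        show "P integrable_on {0..pi / 2}"
          unfolding P_def by (intro integrable_continuous_real continuous_intros)
      qed
      then have "\<bar>integral {0..pi / 2} P - M\<bar> \<le> K * R"
        using near' far by (simp add: K_def algebra_simps)
      then show ?case
        by (simp add: P_def[abs_def] M_def A_def R_def)
    qed
  qed
qed

end
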